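(* Let $X=\mathbb P^2$, $G=SL_3$. The set of first order homogeneous constant coefficient operators $\delta=\sum_I\lambda_I\partial_I$ for which $\mathcal N(\delta)$ is nonempty, regarded as a subset of $V^\vee$ (identifying $\delta$ with the vector $(\lambda_I)$), is dense in $V^\vee$ in the analytic topology. Hence it is dense in the Zariski topology.
   Context: $V^\vee=\Gamma(\mathbb P^2,\mathcal O(3))\cong\mathbb C^{10}$ is the space of ternary cubic forms in $x_1,x_2,x_3$, with linear coordinates $a_I$, $I=(ijk)$, $i+j+k=3$, proportional to the coefficients of the monomials $x^I=x_1^ix_2^jx_3^k$ (the result does not depend on rescaling the individual $a_I$), and $\partial_I=\partial/\partial a_I$. $B\subset V^\vee$ is the set of cubics defining a smooth plane curve. The tautological system $\tau$ on $V^\vee$ for $X=\mathbb P^2$, $G=SL_3$: let $c_I$ be the coordinates on $V^\vee$ given by the coefficients of the monomials $x^I$. The solution sheaf $\mathrm{sol}(\tau)$ consists of holomorphic functions $s$ on $V^\vee$ such that $P\big((\partial/\partial c_I)_I\big)s=0$ for every polynomial $P$ in 10 variables with $P\big((x^I)_I\big)=0$ in $\mathbb C[x_1,x_2,x_3]$; $s$ is annihilated by the vector fields of the natural $\mathfrak{sl}_3$-action on $V^\vee$; and $(\sum_Ic_I\frac{\partial}{\partial c_I}+1)s=0$. For a differential operator $\delta$, $\mathcal N(\delta)=\{b\in B\mid\delta s(b)=0\ \ \forall s\in\mathrm{sol}(\tau)_b\}$. *)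

theory Defs
  imports "HOL-Analysis.Analysis" "HOL-Library.Poly_Mapping"
begin

type_synonym 'v mpoly = "('v \<Rightarrow>\<^sub>0 nat) \<Rightarrow>\<^sub>0 complex"

definition mp_eval :: "(complex \<Rightarrow> 'r) \<Rightarrow> ('v \<Rightarrow> 'r) \<Rightarrow> 'v mpoly \<Rightarrow> 'r::comm_semiring_1"
  where "mp_eval \<iota> x P =
    (\<Sum>m\<in>Poly_Mapping.keys P. \<iota> (Poly_Mapping.lookup P m) *
       (\<Prod>v\<in>Poly_Mapping.keys m. x v ^ Poly_Mapping.lookup m v))"

definition mp_Var :: "'v \<Rightarrow> 'v mpoly"
  where "mp_Var v = Poly_Mapping.single (Poly_Mapping.single v 1) 1"

definition mp_Const :: "complex \<Rightarrow> 'v mpoly"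
  where "mp_Const c = Poly_Mapping.single 0 c"

definition mp_deriv :: "'v \<Rightarrow> 'v mpoly \<Rightarrow> 'v mpoly"
  where "mp_deriv v P =
    (\<Sum>m\<in>Poly_Mapping.keys P.
       Poly_Mapping.single (m - Poly_Mapping.single v 1)
         (of_nat (Poly_Mapping.lookup m v) * Poly_Mapping.lookup P m))"

typedef cubic_exp = "{m :: 3 \<Rightarrow>\<^sub>0 nat. (\<Sum>p\<in>UNIV. Poly_Mapping.lookup m p) = 3}"
proof
  show "Poly_Mapping.single 1 3 \<in> {m :: 3 \<Rightarrow>\<^sub>0 nat. (\<Sum>p\<in>UNIV. Poly_Mapping.lookup m p) = 3}"
    by (simp add: lookup_single when_def)
qed

definition cubic_exps :: "cubic_exp list"
  where "cubic_exps =
    [Abs_cubic_exp (Poly_Mapping.single 1 i + Poly_Mapping.single 2 j + Poly_Mapping.single 3 (3 - i - j)).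
       i \<leftarrow> [0..<4], j \<leftarrow> [0..<4 - i]]"

lemma set_cubic_exps: "set cubic_exps = UNIV"
proof -
  have "I \<in> set cubic_exps" for I
  proof -
    define m where "m = Rep_cubic_exp I"
    have s: "Poly_Mapping.lookup m 1 + Poly_Mapping.lookup m 2 + Poly_Mapping.lookup m 3 = 3"
      using Rep_cubic_exp[of I] by (simp add: m_def sum_3)
    have m: "m = Poly_Mapping.single 1 (Poly_Mapping.lookup m 1) + Poly_Mapping.single 2 (Poly_Mapping.lookup m 2)
        + Poly_Mapping.single 3 (3 - Poly_Mapping.lookup m 1 - Poly_Mapping.lookup m 2)"
    proof (rule poly_mapping_eqI)
      fix p :: 3
      show "Poly_Mapping.lookup m p = Poly_Mapping.lookup (Poly_Mapping.single 1 (Poly_Mapping.lookup m 1)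
        + Poly_Mapping.single 2 (Poly_Mapping.lookup m 2)
        + Poly_Mapping.single 3 (3 - Poly_Mapping.lookup m 1 - Poly_Mapping.lookup m 2)) p"
        using exhaust_3[of p] s by (auto simp: lookup_add lookup_single when_def)
    qed
    have "I = Abs_cubic_exp m" by (simp add: m_def Rep_cubic_exp_inverse)
    also have "\<dots> = Abs_cubic_exp (Poly_Mapping.single 1 (Poly_Mapping.lookup m 1) + Poly_Mapping.single 2 (Poly_Mapping.lookup m 2)
        + Poly_Mapping.single 3 (3 - Poly_Mapping.lookup m 1 - Poly_Mapping.lookup m 2))"
      using m by simp
    finally show ?thesis
      using s unfolding cubic_exps_def set_concat set_map by fastforce
  qed
  thus ?thesis by blast
qed

instance cubic_exp :: finite
proof
  show "finite (UNIV :: cubic_exp set)"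
    using finite_set[of cubic_exps] by (simp only: set_cubic_exps)
qed

lemma distinct_cubic_exps: "distinct cubic_exps"
proof -
  have R: "Rep_cubic_exp (Abs_cubic_exp m) = m"
    if "Poly_Mapping.lookup m 1 + Poly_Mapping.lookup m 2 + Poly_Mapping.lookup m 3 = 3" for m
    using that by (simp add: Abs_cubic_exp_inverse sum_3)
  have "distinct (map (\<lambda>I. (Poly_Mapping.lookup (Rep_cubic_exp I) 1, Poly_Mapping.lookup (Rep_cubic_exp I) 2)) cubic_exps)"
    by (simp add: cubic_exps_def upt_rec R lookup_add lookup_single when_def)
  thus ?thesis by (simp add: distinct_map)
qed

lemma CARD_cubic_exp: "CARD(cubic_exp) = 10"
proof -
  have "length cubic_exps = 10"
    by (simp add: cubic_exps_def upt_rec)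
  thus ?thesis
    using distinct_card[OF distinct_cubic_exps] by (simp only: set_cubic_exps)
qed

text \<open>The space of ternary cubics, in the coordinates \<open>c\<^sub>I\<close> (the coefficient of \<open>x\<^sup>I\<close>).\<close>

type_synonym cubic = "complex ^ cubic_exp"

definition x_mon :: "cubic_exp \<Rightarrow> 3 mpoly"
  where "x_mon I = Poly_Mapping.single (Rep_cubic_exp I) 1"

definition cubic_form :: "cubic \<Rightarrow> 3 mpoly"
  where "cubic_form c = (\<Sum>I\<in>UNIV. mp_Const (c $ I) * x_mon I)"

text \<open>Jacobian criterion: the projective plane curve has no singular point. The zero form is excluded,
  every point being singular for it.\<close>

definition smooth_cubics :: "cubic set"
  where "smooth_cubics =
    {c. \<not> (\<exists>x :: complex ^ 3. x \<noteq> 0 \<and> mp_eval id (($) x) (cubic_form c) = 0 \<and>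
             (\<forall>p. mp_eval id (($) x) (mp_deriv p (cubic_form c)) = 0))}"

definition holomorphic_cubics :: "cubic set \<Rightarrow> (cubic \<Rightarrow> complex) \<Rightarrow> bool"
  where "holomorphic_cubics U s \<longleftrightarrow>
    (\<forall>b\<in>U. \<exists>D. (s has_derivative D) (at b) \<and> (\<forall>z v. D (z *s v) = z * D v))"

definition pd :: "cubic_exp \<Rightarrow> (cubic \<Rightarrow> complex) \<Rightarrow> cubic \<Rightarrow> complex"
  where "pd I s b = deriv (\<lambda>t. s (b + axis I t)) 0"

text \<open>The order of composition is immaterial on holomorphic functions, whose partial derivatives
  commute.\<close>

definition pd_mon :: "(cubic_exp \<Rightarrow>\<^sub>0 nat) \<Rightarrow> (cubic \<Rightarrow> complex) \<Rightarrow> cubic \<Rightarrow> complex"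
  where "pd_mon m = foldr (\<lambda>I. pd I ^^ Poly_Mapping.lookup m I) cubic_exps"

definition pd_poly :: "cubic_exp mpoly \<Rightarrow> (cubic \<Rightarrow> complex) \<Rightarrow> cubic \<Rightarrow> complex"
  where "pd_poly P s b =
    (\<Sum>m\<in>Poly_Mapping.keys P. Poly_Mapping.lookup P m * pd_mon m s b)"

text \<open>The group acts on forms by \<open>(g \<cdot> f)(x) = f(g\<^sup>-\<^sup>1 x)\<close>; differentiating at the identity in
  direction \<open>\<xi>\<close> gives \<open>\<xi> \<cdot> f = - (\<Sum>p q. \<xi>\<^sub>p\<^sub>q x\<^sub>q \<partial>f/\<partial>x\<^sub>p)\<close>. The result is read off in
  coefficients, and is the value at \<open>c\<close> of the vector field of \<open>\<xi>\<close>.\<close>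

definition lie_act :: "complex ^ 3 ^ 3 \<Rightarrow> cubic \<Rightarrow> cubic"
  where "lie_act \<xi> c =
    (\<chi> I. Poly_Mapping.lookup
       (- (\<Sum>p\<in>UNIV. \<Sum>q\<in>UNIV. mp_Const (\<xi> $ p $ q) * mp_Var q * mp_deriv p (cubic_form c)))
       (Rep_cubic_exp I))"

text \<open>Sections over an open set \<open>U\<close>; values outside \<open>U\<close> are irrelevant.\<close>

definition sol :: "cubic set \<Rightarrow> (cubic \<Rightarrow> complex) set"
  where "sol U = {s. holomorphic_cubics U s \<and>
    (\<forall>P. mp_eval mp_Const x_mon P = 0 \<longrightarrow> (\<forall>b\<in>U. pd_poly P s b = 0)) \<and>
    (\<forall>\<xi>. trace \<xi> = 0 \<longrightarrow> (\<forall>b\<in>U. (\<Sum>I\<in>UNIV. lie_act \<xi> b $ I * pd I s b) = 0)) \<and>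
    (\<forall>b\<in>U. (\<Sum>I\<in>UNIV. b $ I * pd I s b) + s b = 0)}"

text \<open>Elements of the stalk at \<open>b\<close> are represented by sections over open neighbourhoods of \<open>b\<close>.\<close>

definition diff_zeros :: "((cubic \<Rightarrow> complex) \<Rightarrow> cubic \<Rightarrow> complex) \<Rightarrow> cubic set"
  where "diff_zeros \<delta> =
    {b \<in> smooth_cubics. \<forall>U s. open U \<and> b \<in> U \<and> s \<in> sol U \<longrightarrow> \<delta> s b = 0}"

text \<open>\<open>\<partial>/\<partial>a\<^sub>I\<close> for the coordinates \<open>a\<^sub>I = \<mu>\<^sub>I c\<^sub>I\<close>: raising \<open>a\<^sub>I\<close> by \<open>t\<close> raises \<open>c\<^sub>I\<close> by
  \<open>t / \<mu>\<^sub>I\<close>.\<close>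

definition pd_scaled :: "(cubic_exp \<Rightarrow> complex) \<Rightarrow> cubic_exp \<Rightarrow> (cubic \<Rightarrow> complex) \<Rightarrow> cubic \<Rightarrow> complex"
  where "pd_scaled \<mu> I s b = deriv (\<lambda>t. s (b + axis I (t / \<mu> I))) 0"

definition first_order_op ::
  "(cubic_exp \<Rightarrow> complex) \<Rightarrow> complex ^ cubic_exp \<Rightarrow> (cubic \<Rightarrow> complex) \<Rightarrow> cubic \<Rightarrow> complex"
  where "first_order_op \<mu> l s b = (\<Sum>I\<in>UNIV. l $ I * pd_scaled \<mu> I s b)"

definition zariski_closed :: "(complex ^ 'n) set \<Rightarrow> bool"
  where "zariski_closed Z \<longleftrightarrow>
    (\<exists>F :: 'n mpoly set. Z = {v. \<forall>P\<in>F. mp_eval id (($) v) P = 0})"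

end

theory Submission
  imports Defs
begin

text \<open>
  A solution is annihilated at \<open>b\<close> by every vector \<open>\<xi> \<cdot> b\<close> with \<open>\<xi>\<close> in the Lie algebra, so it suffices
  that the vectors \<open>\<xi> \<cdot> b\<close> with \<open>b\<close> smooth are dense. Smooth cubics are dense, because the singular
  ones are covered by three differentiable images of a hyperplane (two parameters for the singular
  point, seven for the coefficients that it leaves free); hence \<open>b\<close> may be arbitrary. Every vector
  with nonzero coefficient at \<open>x\<^sub>1\<^sup>2 x\<^sub>2\<close> is then of the form \<open>\<xi> \<cdot> b\<close>: a traceless diagonal \<open>\<xi>\<close> never
  reaches \<open>x\<^sub>1 x\<^sub>2 x\<^sub>3\<close>, but adding a multiple of \<open>x\<^sub>3 \<partial>/\<partial>x\<^sub>1\<close> repairs this, and the resulting linear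
  system for \<open>b\<close> is triangular.
\<close>

section \<open>Cubic monomials, and the coefficients and derivatives of a cubic form\<close>

text \<open>Names the exponent only when \<open>i + j + k = 3\<close>; otherwise
  \<open>Abs_cubic_exp\<close> is applied outside its carrier, hence the degree hypotheses
  below.\<close>

definition cexp :: "nat \<Rightarrow> nat \<Rightarrow> nat \<Rightarrow> cubic_exp" where
 "cexp i j k = Abs_cubic_exp (Poly_Mapping.single 1 i + Poly_Mapping.single 2 j + Poly_Mapping.single 3 k)"

lemma cubic_exps_eq: "cubic_exps = [cexp 0 0 3, cexp 0 1 2, cexp 0 2 1, cexp 0 3 0, cexp 1 0 2, cexp 1 1 1, cexp 1 2 0, cexp 2 0 1, cexp 2 1 0, cexp 3 0 0]"
  unfolding cubic_exps_def cexp_def by (simp add: upt_rec numeral_eq_Suc)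

lemma UNIV_cubic_exp: "UNIV = {cexp 0 0 3, cexp 0 1 2, cexp 0 2 1, cexp 0 3 0, cexp 1 0 2, cexp 1 1 1, cexp 1 2 0, cexp 2 0 1, cexp 2 1 0, cexp 3 0 0}"
  using set_cubic_exps unfolding cubic_exps_eq by auto

lemma lookup_cexp:
  assumes "i + j + k = 3"
  shows "Poly_Mapping.lookup (Rep_cubic_exp (cexp i j k)) 1 = i"
    "Poly_Mapping.lookup (Rep_cubic_exp (cexp i j k)) 2 = j" "Poly_Mapping.lookup (Rep_cubic_exp (cexp i j k)) 3 = k"
proof -
  have "Rep_cubic_exp (cexp i j k) = Poly_Mapping.single 1 i + Poly_Mapping.single 2 j + Poly_Mapping.single 3 k"
    unfolding cexp_def using assms by (intro Abs_cubic_exp_inverse) (simp add: sum_3 lookup_add lookup_single when_def)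
  then show "Poly_Mapping.lookup (Rep_cubic_exp (cexp i j k)) 1 = i"
    "Poly_Mapping.lookup (Rep_cubic_exp (cexp i j k)) 2 = j" "Poly_Mapping.lookup (Rep_cubic_exp (cexp i j k)) 3 = k"
    by (simp_all add: lookup_add lookup_single when_def)
qed

lemma cexp_eq_iff:
  assumes "i + j + k = 3" "i' + j' + k' = 3"
  shows "cexp i j k = cexp i' j' k' \<longleftrightarrow> i = i' \<and> j = j'"
  using lookup_cexp[OF assms(1)] lookup_cexp[OF assms(2)] assms by (metis add_left_cancel)

lemma sum_cubic_exp: "(\<Sum>I\<in>UNIV. h I) = h (cexp 0 0 3) + h (cexp 0 1 2) + h (cexp 0 2 1) + h (cexp 0 3 0) + h (cexp 1 0 2)
  + h (cexp 1 1 1) + h (cexp 1 2 0) + h (cexp 2 0 1) + h (cexp 2 1 0) + h (cexp 3 0 0)" for h :: "_ \<Rightarrow> 'a::comm_monoid_add"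
  using sum_list_distinct_conv_sum_set[OF distinct_cubic_exps, of h]
  unfolding set_cubic_exps by (simp add: cubic_exps_eq add.assoc)

lemma lookup_cubic_form: "Poly_Mapping.lookup (cubic_form c) (Rep_cubic_exp I) = c $ I"
  by (simp add: cubic_form_def x_mon_def mp_Const_def mult_single lookup_sum lookup_single when_def Rep_cubic_exp_inject)

lemma keys_cubic_form: "Poly_Mapping.keys (cubic_form c) \<subseteq> range Rep_cubic_exp"
proof
  fix m assume "m \<in> Poly_Mapping.keys (cubic_form c)"
  then have "(\<Sum>I\<in>UNIV. if Rep_cubic_exp I = m then c $ I else 0) \<noteq> 0"
    by (simp add: cubic_form_def x_mon_def mp_Const_def mult_single lookup_sum lookup_single in_keys_iff when_def)
  then obtain I where "(if Rep_cubic_exp I = m then c $ I else 0) \<noteq> 0"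
    by (rule sum.not_neutral_contains_not_neutral)
  then show "m \<in> range Rep_cubic_exp" by (auto split: if_splits)
qed

text \<open>Summing over all cubic exponents instead of the keys adds only zero terms. Truncated
  subtraction does no harm: where \<open>p\<close> does not occur in the monomial, the factor
  \<open>lookup (Rep_cubic_exp I) p\<close> is zero.\<close>

lemma mp_deriv_cubic_form:
  "mp_deriv p (cubic_form c) = (\<Sum>I\<in>UNIV. Poly_Mapping.single (Rep_cubic_exp I - Poly_Mapping.single p 1)
     (of_nat (Poly_Mapping.lookup (Rep_cubic_exp I) p) * c $ I))"
proof -
  have "mp_deriv p (cubic_form c) = (\<Sum>m\<in>range Rep_cubic_exp. Poly_Mapping.single (m - Poly_Mapping.single p 1)
         (of_nat (Poly_Mapping.lookup m p) * Poly_Mapping.lookup (cubic_form c) m))"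
    unfolding mp_deriv_def using keys_cubic_form
    by (intro sum.mono_neutral_left) (auto simp: in_keys_iff)
  then show ?thesis
    by (simp add: sum.reindex inj_on_def Rep_cubic_exp_inject lookup_cubic_form)
qed

text \<open>Evaluation is additive, although \<open>mp_eval\<close> runs over keys: several indices
  may share an exponent and their coefficients may cancel, so the terms are regrouped over the image
  of \<open>f\<close>.\<close>

lemma mp_eval_sum_single:
  fixes x :: "'v::finite \<Rightarrow> complex"
  assumes "finite S"
  shows "mp_eval id x (\<Sum>i\<in>S. Poly_Mapping.single (f i) (a i)) = (\<Sum>i\<in>S. a i * (\<Prod>v\<in>UNIV. x v ^ Poly_Mapping.lookup (f i) v))"
proof -
  let ?P = "\<Sum>i\<in>S. Poly_Mapping.single (f i) (a i)"
  have mon: "(\<Prod>v\<in>Poly_Mapping.keys m. x v ^ Poly_Mapping.lookup m v) = (\<Prod>v\<in>UNIV. x v ^ Poly_Mapping.lookup m v)" for m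
    by (rule prod.mono_neutral_left) (auto simp: in_keys_iff)
  have lk: "Poly_Mapping.lookup ?P m = (\<Sum>i\<in>S. if f i = m then a i else 0)" for m
    by (simp add: lookup_sum lookup_single when_def)
  have "Poly_Mapping.keys ?P \<subseteq> f ` S"
  proof
    fix m assume "m \<in> Poly_Mapping.keys ?P"
    then have "(\<Sum>i\<in>S. if f i = m then a i else 0) \<noteq> 0" by (simp add: in_keys_iff lk)
    then obtain i where "i \<in> S" "(if f i = m then a i else 0) \<noteq> 0"
      by (rule sum.not_neutral_contains_not_neutral)
    then show "m \<in> f ` S" by (auto split: if_splits)
  qed
  then have "mp_eval id x ?P = (\<Sum>m\<in>f ` S. Poly_Mapping.lookup ?P m * (\<Prod>v\<in>UNIV. x v ^ Poly_Mapping.lookup m v))"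
    unfolding mp_eval_def mon using assms by (intro sum.mono_neutral_cong_left) (auto simp: in_keys_iff)
  also have "\<dots> = (\<Sum>i\<in>S. \<Sum>m\<in>f ` S. if m = f i then a i * (\<Prod>v\<in>UNIV. x v ^ Poly_Mapping.lookup m v) else 0)"
    unfolding lk sum_distrib_right by (subst sum.swap) (auto intro!: sum.cong)
  also have "\<dots> = (\<Sum>i\<in>S. a i * (\<Prod>v\<in>UNIV. x v ^ Poly_Mapping.lookup (f i) v))"
    using assms by (intro sum.cong) (auto simp: sum.delta)
  finally show ?thesis .
qed

lemma prod_UNIV_3: "(\<Prod>v\<in>UNIV. h v) = h 1 * h 2 * h (3::3)" for h :: "3 \<Rightarrow> 'a::comm_monoid_mult"
  unfolding UNIV_3 by (simp add: ac_simps)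

lemma prod_deriv_exponents:
  fixes x :: "3 \<Rightarrow> complex"
  shows "(\<Prod>v\<in>UNIV. x v ^ Poly_Mapping.lookup (m - Poly_Mapping.single 1 1) v)
      = x 1 ^ (Poly_Mapping.lookup m 1 - 1) * x 2 ^ Poly_Mapping.lookup m 2 * x 3 ^ Poly_Mapping.lookup m 3"
    "(\<Prod>v\<in>UNIV. x v ^ Poly_Mapping.lookup (m - Poly_Mapping.single 2 1) v)
      = x 1 ^ Poly_Mapping.lookup m 1 * x 2 ^ (Poly_Mapping.lookup m 2 - 1) * x 3 ^ Poly_Mapping.lookup m 3"
    "(\<Prod>v\<in>UNIV. x v ^ Poly_Mapping.lookup (m - Poly_Mapping.single 3 1) v)
      = x 1 ^ Poly_Mapping.lookup m 1 * x 2 ^ Poly_Mapping.lookup m 2 * x 3 ^ (Poly_Mapping.lookup m 3 - 1)"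
  unfolding prod_UNIV_3 lookup_minus lookup_single by (simp_all add: when_def)

lemma mp_eval_mp_deriv_cubic_form:
  fixes x :: "complex ^ 3"
  shows "mp_eval id (($) x) (mp_deriv 1 (cubic_form c)) = 3 * c $ cexp 3 0 0 * (x$1)^2 + 2 * c $ cexp 2 1 0 * x$1 * x$2 + 2 * c $ cexp 2 0 1 * x$1 * x$3
     + c $ cexp 1 2 0 * (x$2)^2 + c $ cexp 1 1 1 * x$2 * x$3 + c $ cexp 1 0 2 * (x$3)^2" (is ?t1)
   and "mp_eval id (($) x) (mp_deriv 2 (cubic_form c)) = c $ cexp 2 1 0 * (x$1)^2 + 2 * c $ cexp 1 2 0 * x$1 * x$2 + c $ cexp 1 1 1 * x$1 * x$3
     + 3 * c $ cexp 0 3 0 * (x$2)^2 + 2 * c $ cexp 0 2 1 * x$2 * x$3 + c $ cexp 0 1 2 * (x$3)^2" (is ?t2)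
   and "mp_eval id (($) x) (mp_deriv 3 (cubic_form c)) = c $ cexp 2 0 1 * (x$1)^2 + c $ cexp 1 1 1 * x$1 * x$2 + 2 * c $ cexp 1 0 2 * x$1 * x$3
     + c $ cexp 0 2 1 * (x$2)^2 + 2 * c $ cexp 0 1 2 * x$2 * x$3 + 3 * c $ cexp 0 0 3 * (x$3)^2" (is ?t3)
proof -
  have nat_minus_1: "(1::nat) - 1 = 0" "(2::nat) - 1 = 1" "(3::nat) - 1 = 2" by simp_all
  show ?t1 ?t2 ?t3
    unfolding mp_deriv_cubic_form mp_eval_sum_single[OF finite] prod_deriv_exponents
    unfolding sum_cubic_exp
    by (simp_all only: lookup_cexp arith_simps rel_simps of_nat_numeral of_nat_0 of_nat_1 mult_zero_left mult_1_left
      mult_1_right power_0 power_one_right nat_minus_1 ac_simps)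
qed

section \<open>The Lie algebra action on coefficients\<close>

text \<open>The operator \<open>x_q d/dx_p\<close> moves one unit of exponent from \<open>p\<close>
  to \<open>q\<close>, so the entry at \<open>J\<close> collects those \<open>I\<close> that become
  \<open>J\<close> by such a move.\<close>

lemma lie_act_eq:
  "lie_act \<xi> c $ J = - (\<Sum>p\<in>UNIV. \<Sum>q\<in>UNIV. \<Sum>I\<in>UNIV.
     if Poly_Mapping.single q 1 + (Rep_cubic_exp I - Poly_Mapping.single p 1) = Rep_cubic_exp J
     then \<xi> $ p $ q * (of_nat (Poly_Mapping.lookup (Rep_cubic_exp I) p) * c $ I) else 0)"
  by (simp add: lie_act_def mp_deriv_cubic_form mp_Const_def mp_Var_def mult_single sum_distrib_left lookup_sum lookup_single when_def)

lemma three_mapping_eq_iff: "m = m' \<longleftrightarrow> Poly_Mapping.lookup m 1 = Poly_Mapping.lookup m' 1 \<and> Poly_Mapping.lookup m 2 = Poly_Mapping.lookup m' 2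
  \<and> Poly_Mapping.lookup m 3 = Poly_Mapping.lookup m' 3" for m m' :: "3 \<Rightarrow>\<^sub>0 nat"
  by (auto intro!: poly_mapping_eqI) (metis exhaust_3)

lemma continuous_on_lie_act: "continuous_on S (lie_act \<xi>)"
proof -
  have "continuous_on S (\<lambda>c :: cubic. if P then z * (a * c $ I) else 0)" for P z a I
    by (cases P) (auto intro!: continuous_intros)
  then have "continuous_on S (\<lambda>c. \<chi> J. lie_act \<xi> c $ J)"
    unfolding lie_act_eq by (intro continuous_intros)
  then show ?thesis by simp
qed

lemma cubic_exp_eq_iff: "I = J \<longleftrightarrow> (\<forall>p. Poly_Mapping.lookup (Rep_cubic_exp I) p = Poly_Mapping.lookup (Rep_cubic_exp J) p)"
  by (metis Rep_cubic_exp_inject poly_mapping_eqI)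

text \<open>Every monomial is an eigenvector of \<open>x_p d/dx_p\<close>, with its exponent at
  \<open>p\<close> as eigenvalue.\<close>

lemma sum_lie_act_diagonal:
  fixes c :: cubic
  shows "(\<Sum>I\<in>UNIV. if Poly_Mapping.single p 1 + (Rep_cubic_exp I - Poly_Mapping.single p 1) = Rep_cubic_exp J
     then z * (of_nat (Poly_Mapping.lookup (Rep_cubic_exp I) p) * c $ I) else 0)
   = z * of_nat (Poly_Mapping.lookup (Rep_cubic_exp J) p) * c $ J" (is "(\<Sum>I\<in>UNIV. ?f I) = _")
proof -
  have "?f I = (if I = J then z * of_nat (Poly_Mapping.lookup (Rep_cubic_exp J) p) * c $ J else 0)" for I
  proof (cases "Poly_Mapping.lookup (Rep_cubic_exp I) p = 0")
    case False
    then have "Poly_Mapping.single p 1 + (Rep_cubic_exp I - Poly_Mapping.single p 1) = Rep_cubic_exp I"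
      by (intro poly_mapping_eqI) (auto simp: lookup_add lookup_minus lookup_single when_def)
    then show ?thesis by (simp add: Rep_cubic_exp_inject)
  qed auto
  then show ?thesis by simp
qed

text \<open>Under \<open>x_3 d/dx_1\<close> the target monomial has a single source, with one more
  \<open>x_1\<close> and one fewer \<open>x_3\<close>. For \<open>k = 0\<close> there is no source,
  and \<open>cexp (i + 1) j (k - 1)\<close> would have degree four.\<close>

lemma sum_lie_act_13:
  fixes c :: cubic
  assumes "i + j + k = 3"
  shows "(\<Sum>I\<in>UNIV. if Poly_Mapping.single 3 1 + (Rep_cubic_exp I - Poly_Mapping.single 1 1) = Rep_cubic_exp (cexp i j k)
     then z * (of_nat (Poly_Mapping.lookup (Rep_cubic_exp I) 1) * c $ I) else 0)
   = (if k = 0 then 0 else z * of_nat (i + 1) * c $ cexp (i + 1) j (k - 1))" (is "(\<Sum>I\<in>UNIV. ?f I) = _")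
proof -
  have "?f I = (if I = cexp (i + 1) j (k - 1) \<and> k \<noteq> 0 then z * of_nat (i + 1) * c $ cexp (i + 1) j (k - 1) else 0)" for I
  proof (cases "Poly_Mapping.lookup (Rep_cubic_exp I) 1 = 0 \<or> k = 0")
    case True
    then show ?thesis using assms
      by (auto simp: three_mapping_eq_iff lookup_add lookup_minus lookup_single when_def lookup_cexp)
  next
    case False
    then have "Poly_Mapping.single 3 1 + (Rep_cubic_exp I - Poly_Mapping.single 1 1) = Rep_cubic_exp (cexp i j k) \<longleftrightarrow> I = cexp (i + 1) j (k - 1)"
      using assms
      by (auto simp: three_mapping_eq_iff cubic_exp_eq_iff forall_3 lookup_add lookup_minus lookup_single when_def lookup_cexp)
    with False show ?thesis using assms by (simp add: lookup_cexp)
  qed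
  then show ?thesis by simp
qed

text \<open>For the diagonal \<open>(1, 2, -3)\<close> the only cubic monomial of weight zero is \<open>x\<^sub>1 x\<^sub>2 x\<^sub>3\<close>.\<close>

definition shear :: "complex \<Rightarrow> complex ^ 3 ^ 3"
  where "shear s = (\<chi> p q. if p = q then (if p = 1 then 1 else if p = 2 then 2 else -3)
     else if p = 1 \<and> q = 3 then s else 0)"

lemma lie_act_shear:
  assumes "i + j + k = 3"
  shows "lie_act (shear s) c $ cexp i j k = - ((of_nat i + 2 * of_nat j - 3 * of_nat k) * c $ cexp i j k
     + (if k = 0 then 0 else s * of_nat (i + 1) * c $ cexp (i + 1) j (k - 1)))"
proof -
  let ?T = "\<lambda>p q. \<Sum>I\<in>UNIV.
     if Poly_Mapping.single q 1 + (Rep_cubic_exp I - Poly_Mapping.single p 1) = Rep_cubic_exp (cexp i j k)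
     then shear s $ p $ q * (of_nat (Poly_Mapping.lookup (Rep_cubic_exp I) p) * c $ I) else 0"
  have z: "?T p q = 0" if "shear s $ p $ q = 0" for p q
    by (simp only: that mult_zero_left if_cancel sum.neutral_const)
  have "?T 1 2 = 0" "?T 2 1 = 0" "?T 2 3 = 0" "?T 3 1 = 0" "?T 3 2 = 0"
    by (rule z, simp add: shear_def)+
  then have "lie_act (shear s) c $ cexp i j k = - (?T 1 1 + ?T 1 3 + ?T 2 2 + ?T 3 3)"
    unfolding lie_act_eq sum_3 by (simp only: add_0_left add_0_right add.assoc)
  also have "\<dots> = - ((of_nat i + 2 * of_nat j - 3 * of_nat k) * c $ cexp i j k
     + (if k = 0 then 0 else s * of_nat (i + 1) * c $ cexp (i + 1) j (k - 1)))"
    unfolding sum_lie_act_diagonal sum_lie_act_13[OF assms] lookup_cexp[OF assms]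
    by (simp add: shear_def algebra_simps)
  finally show ?thesis .
qed

text \<open>By \<open>lie_act_shear\<close> the equations for different \<open>j\<close> are
  independent, and for fixed \<open>j\<close> they are solved in order of increasing
  \<open>k\<close>, dividing by the weight \<open>i + 2j - 3k\<close>. The weight vanishes only at
  \<open>cexp 1 1 1\<close>, where \<open>s\<close> is chosen instead.\<close>

lemma lie_act_solvable:
  fixes l :: cubic
  assumes "l $ cexp 2 1 0 \<noteq> 0"
  obtains \<xi> b where "trace \<xi> = 0" "lie_act \<xi> b = l"
proof -
  \<comment> \<open>Forced by the equation at \<open>cexp 1 1 1\<close>, which reads
    \<open>- 2 * s * b $ cexp 2 1 0 = l $ cexp 1 1 1\<close>, with
    \<open>b $ cexp 2 1 0 = - l $ cexp 2 1 0 / 4\<close>.\<close>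
  define s where "s = 2 * l $ cexp 1 1 1 / l $ cexp 2 1 0"
  define c201 where "c201 = l $ cexp 2 0 1 - s * l $ cexp 3 0 0"
  define c102 where "c102 = (l $ cexp 1 0 2 + 2 * s * c201) / 5"
  \<comment> \<open>The divisors are the weights up to sign. The entry at \<open>cexp 1 1 1\<close>
    is free and set to zero; the last default is the entry at \<open>cexp 0 3 0\<close>.\<close>
  define b :: cubic where "b = (\<chi> I.
     if I = cexp 3 0 0 then - l $ I / 3 else if I = cexp 2 0 1 then c201 else if I = cexp 1 0 2 then c102
     else if I = cexp 0 0 3 then (l $ I + s * c102) / 9
     else if I = cexp 2 1 0 then - l $ I / 4 else if I = cexp 1 1 1 then 0 else if I = cexp 0 1 2 then l $ I / 4
     else if I = cexp 1 2 0 then - l $ I / 5 else if I = cexp 0 2 1 then s * l $ cexp 1 2 0 / 5 - l $ I else - l $ I / 6)"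
  have b: "b $ cexp 3 0 0 = - l $ cexp 3 0 0 / 3" "b $ cexp 2 0 1 = c201" "b $ cexp 1 0 2 = c102"
    "b $ cexp 0 0 3 = (l $ cexp 0 0 3 + s * c102) / 9" "b $ cexp 2 1 0 = - l $ cexp 2 1 0 / 4" "b $ cexp 1 1 1 = 0"
    "b $ cexp 0 1 2 = l $ cexp 0 1 2 / 4" "b $ cexp 1 2 0 = - l $ cexp 1 2 0 / 5"
    "b $ cexp 0 2 1 = s * l $ cexp 1 2 0 / 5 - l $ cexp 0 2 1" "b $ cexp 0 3 0 = - l $ cexp 0 3 0 / 6"
    by (simp_all add: b_def cexp_eq_iff)
  \<comment> \<open>The other nine equations hold for every value of \<open>s\<close>; only this one
    unfolds it and cancels \<open>l $ cexp 2 1 0\<close>.\<close>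
  have e111: "lie_act (shear s) b $ cexp 1 1 1 = l $ cexp 1 1 1"
    using assms by (simp add: lie_act_shear b s_def del: One_nat_def)
  have "\<forall>J\<in>UNIV. lie_act (shear s) b $ J = l $ J"
    unfolding UNIV_cubic_exp
    by (simp add: e111 lie_act_shear b del: One_nat_def; simp add: b[unfolded One_nat_def] c201_def c102_def field_simps)
  then have "lie_act (shear s) b = l" by (simp add: vec_eq_iff)
  moreover have "trace (shear s) = 0" by (simp add: trace_def sum_3 shear_def)
  ultimately show ?thesis by (rule that[rotated])
qed

section \<open>Lie algebra vectors as operators that kill all solutions\<close>

text \<open>Chain rule along a complex line. The complex homogeneity in
  \<open>holomorphic_cubics\<close> turns the real derivative into a complex one and lets the factor
  be pulled out.\<close>

lemma pd_scaled_eq: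
  assumes "holomorphic_cubics U s" "b \<in> U" "\<mu> I \<noteq> 0"
  shows "pd_scaled \<mu> I s b = pd I s b / \<mu> I"
proof -
  obtain D where D: "(s has_derivative D) (at b)" "\<And>z v. D (z *s v) = z * D v"
    using assms unfolding holomorphic_cubics_def by blast
  have ax: "axis I t = t *s axis I (1::complex)" for t by (simp add: vec_eq_iff axis_def)
  have lin: "bounded_linear (\<lambda>t::complex. axis I (t * k) :: cubic)" for k
    by (intro linear_conv_bounded_linear[THEN iffD1] linearI) (simp_all add: vec_eq_iff axis_def algebra_simps)
  have "((\<lambda>t. s (b + axis I (t * k))) has_field_derivative k * D (axis I 1)) (at 0)" for k
  proof -
    have "((\<lambda>t::complex. b + axis I (t * k)) has_derivative (\<lambda>t. axis I (t * k))) (at 0)"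
      using has_derivative_add[OF has_derivative_const bounded_linear_imp_has_derivative[OF lin]] by simp
    moreover have "(s has_derivative D) (at (b + axis I (0 * k)))"
      using D(1) by (simp add: axis_def zero_vec_def[symmetric])
    ultimately have "((\<lambda>t. s (b + axis I (t * k))) has_derivative (\<lambda>t. D (axis I (t * k)))) (at 0)"
      by (rule has_derivative_compose)
    moreover have "D (axis I (t * k)) = k * D (axis I 1) * t" for t
      by (subst ax) (simp add: D(2))
    ultimately show ?thesis by (simp add: has_field_derivative_def)
  qed
  \<comment> \<open>The factor \<open>1\<close> gives \<open>pd\<close>, the factor
    \<open>1 / \<mu> I\<close> gives \<open>pd_scaled\<close>.\<close>
  from this[of 1] this[of "1 / \<mu> I"] show ?thesis
    by (simp add: pd_scaled_def pd_def DERIV_imp_deriv)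
qed

text \<open>The weights \<open>\<mu> I\<close> cancel the rescaling of the partial derivatives,
  which leaves the vector field of \<open>\<xi>\<close> at \<open>b\<close>; this annihilates every
  solution by the definition of \<open>sol\<close>.\<close>

lemma diff_zeros_lie_act:
  assumes "\<And>I. \<mu> I \<noteq> 0" "trace \<xi> = 0" "b \<in> smooth_cubics"
  shows "b \<in> diff_zeros (first_order_op \<mu> (\<chi> I. \<mu> I * lie_act \<xi> b $ I))"
  using assms by (auto simp: diff_zeros_def sol_def first_order_op_def pd_scaled_eq)

section \<open>Density of the smooth cubics\<close>

lemma closure_Compl_negligible:
  fixes S :: "'a::euclidean_space set"
  assumes "negligible S" shows "closure (- S) = UNIV"
proof -
  have "interior S = {}"
    using open_not_negligible[OF open_interior] negligible_subset[OF assms interior_subset] by blast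
  then show ?thesis by (simp add: closure_complement)
qed

text \<open>The complex hyperplane lies in the real one where the real part of the coordinate
  vanishes.\<close>

lemma negligible_coord_zero: "negligible {w :: complex ^ 'n. w $ k = 0}"
proof (rule negligible_subset)
  show "negligible {w :: complex ^ 'n. w \<bullet> axis k 1 = 0}"
    by (rule negligible_standard_hyperplane) (simp add: axis_in_Basis_iff Basis_complex_def)
qed (auto simp: inner_axis)

text \<open>Reduces the real componentwise criterion to complex coordinates: each real basis
  component is an inner product applied to one complex coordinate.\<close>

lemma differentiable_on_vec:
  fixes f :: "'a::real_normed_vector \<Rightarrow> complex ^ 'n"
  assumes "\<And>i. (\<lambda>x. f x $ i) differentiable_on S"
  shows "f differentiable_on S"
  unfolding differentiable_on_def
proof
  fix x assume x: "x \<in> S"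
  have "(\<lambda>x. f x \<bullet> i) differentiable (at x within S)" if i_Basis: "i \<in> Basis" for i
  proof -
    obtain k b where i: "i = axis k b" using i_Basis unfolding Basis_vec_def by blast
    obtain D where "((\<lambda>x. f x $ k) has_derivative D) (at x within S)"
      using assms[of k] x unfolding differentiable_on_def differentiable_def by blast
    from has_derivative_inner_left[OF this, of b] show ?thesis
      unfolding i inner_axis differentiable_def by blast
  qed
  then show "f differentiable (at x within S)"
    by (blast intro: differentiable_componentwise_within[THEN iffD2])
qed

text \<open>The equations are the vanishing of the three partial derivatives at a point \<open>(u, v, 1)\<close>. They
  determine the coefficients \<open>i\<close>, \<open>j\<close>, \<open>k\<close> from the other seven, so the slots \<open>i\<close> and \<open>j\<close> of the
  parameter are free to carry \<open>u\<close> and \<open>v\<close>, and slot \<open>k\<close> is set to zero.\<close>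

lemma negligible_singular_chart:
  fixes i j k :: "'n::finite"
  assumes "i \<noteq> j" "i \<noteq> k" "j \<noteq> k" "{i1,i2,i3,i4,i5,i6,i7} \<inter> {i,j,k} = {}"
  shows "negligible {c :: complex ^ 'n. \<exists>u v.
     3 * c $ i1 * u^2 + 2 * c $ i2 * u * v + 2 * c $ i3 * u + c $ i4 * v^2 + c $ i5 * v + c $ i = 0 \<and>
     c $ i2 * u^2 + 2 * c $ i4 * u * v + c $ i5 * u + 3 * c $ i6 * v^2 + 2 * c $ i7 * v + c $ j = 0 \<and>
     c $ i3 * u^2 + c $ i5 * u * v + 2 * c $ i * u + c $ i7 * v^2 + 2 * c $ j * v + 3 * c $ k = 0}" (is "negligible ?B")
proof -
  define g where "g w = - (3 * w $ i1 * (w $ i)^2 + 2 * w $ i2 * w $ i * w $ j + 2 * w $ i3 * w $ i + w $ i4 * (w $ j)^2 + w $ i5 * w $ j)" for w :: "complex ^ 'n"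
  define h where "h w = - (w $ i2 * (w $ i)^2 + 2 * w $ i4 * w $ i * w $ j + w $ i5 * w $ i + 3 * w $ i6 * (w $ j)^2 + 2 * w $ i7 * w $ j)" for w :: "complex ^ 'n"
  \<comment> \<open>\<open>g w\<close> and \<open>h w\<close> stand in for the coefficients
    \<open>i\<close> and \<open>j\<close> of the third equation, because those slots of
    \<open>w\<close> hold the point.\<close>
  define r where "r w = (- 1 / 3) * (w $ i3 * (w $ i)^2 + w $ i5 * w $ i * w $ j + 2 * g w * w $ i + w $ i7 * (w $ j)^2 + 2 * h w * w $ j)" for w :: "complex ^ 'n"
  define F where "F w = (\<chi> I. if I = i then g w else if I = j then h w else if I = k then r w else w $ I)" for w
  have nth: "(\<lambda>w :: complex ^ 'n. w $ I) differentiable_on S" for I S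
    by (intro linear_imp_differentiable_on bounded_linear.linear bounded_linear_vec_nth)
  have g: "g differentiable_on S" for S unfolding g_def
    by (auto intro!: derivative_intros nth simp: power2_eq_square)
  have h: "h differentiable_on S" for S unfolding h_def
    by (auto intro!: derivative_intros nth simp: power2_eq_square)
  have r: "r differentiable_on S" for S unfolding r_def power2_eq_square
    by (intro derivative_intros nth g h)
  have "F differentiable_on {w. w $ k = 0}"
  proof (rule differentiable_on_vec)
    fix I show "(\<lambda>w. F w $ I) differentiable_on {w. w $ k = 0}"
      by (cases "I = i"; cases "I = j"; cases "I = k") (simp_all add: F_def g h r nth)
  qed
  \<comment> \<open>A differentiable map of the space to itself carries the negligible hyperplane to
    a negligible set.\<close>
  then have "negligible (F ` {w. w $ k = 0})"
    by (intro negligible_differentiable_image_negligible negligible_coord_zero) auto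
  moreover have "?B \<subseteq> F ` {w. w $ k = 0}"
  proof
    fix c assume "c \<in> ?B"
    then obtain u v where
      eqs: "3 * c $ i1 * u^2 + 2 * c $ i2 * u * v + 2 * c $ i3 * u + c $ i4 * v^2 + c $ i5 * v + c $ i = 0"
     "c $ i2 * u^2 + 2 * c $ i4 * u * v + c $ i5 * u + 3 * c $ i6 * v^2 + 2 * c $ i7 * v + c $ j = 0"
     "c $ i3 * u^2 + c $ i5 * u * v + 2 * c $ i * u + c $ i7 * v^2 + 2 * c $ j * v + 3 * c $ k = 0" by blast
    define w where "w = (\<chi> I. if I = i then u else if I = j then v else if I = k then 0 else c $ I)"
    have w: "w $ i = u" "w $ j = v" "w $ k = 0" "\<And>I. I \<notin> {i,j,k} \<Longrightarrow> w $ I = c $ I"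
      using assms by (auto simp: w_def)
    have ne: "I \<notin> {i,j,k}" if "I \<in> {i1,i2,i3,i4,i5,i6,i7}" for I using that assms(4) by blast
    have wn: "w $ i1 = c $ i1" "w $ i2 = c $ i2" "w $ i3 = c $ i3" "w $ i4 = c $ i4" "w $ i5 = c $ i5" "w $ i6 = c $ i6" "w $ i7 = c $ i7"
      by (rule w(4), rule ne, simp)+
    have gw: "g w = c $ i" unfolding g_def w(1-3) wn using eqs(1) by (metis neg_eq_iff_add_eq_0)
    have hw: "h w = c $ j" unfolding h_def w(1-3) wn using eqs(2) by (metis neg_eq_iff_add_eq_0)
    have "(c $ i3 * u^2 + c $ i5 * u * v + 2 * c $ i * u + c $ i7 * v^2 + 2 * c $ j * v) = - (3 * c $ k)"
      using eqs(3) by (metis eq_neg_iff_add_eq_0)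
    then have rw: "r w = c $ k" unfolding r_def gw hw w(1-3) wn by (simp add: field_simps)
    have "c = F w" using w(4) by (auto simp: F_def vec_eq_iff gw hw rw)
    then show "c \<in> F ` {w. w $ k = 0}" using w(3) by blast
  qed
  ultimately show ?thesis by (rule negligible_subset)
qed

text \<open>A singular point has a nonzero coordinate, which can be scaled to one; this gives three
  charts, each with a negligible set of cubics.\<close>

lemma closure_smooth_cubics: "closure smooth_cubics = UNIV"
proof -
  define B where "B i1 i2 i3 i4 i5 i6 i7 i j k = {c :: cubic. \<exists>u v.
     3 * c $ i1 * u^2 + 2 * c $ i2 * u * v + 2 * c $ i3 * u + c $ i4 * v^2 + c $ i5 * v + c $ i = 0 \<and>
     c $ i2 * u^2 + 2 * c $ i4 * u * v + c $ i5 * u + 3 * c $ i6 * v^2 + 2 * c $ i7 * v + c $ j = 0 \<and>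
     c $ i3 * u^2 + c $ i5 * u * v + 2 * c $ i * u + c $ i7 * v^2 + 2 * c $ j * v + 3 * c $ k = 0}"
     for i1 i2 i3 i4 i5 i6 i7 i j k
  \<comment> \<open>The three index lists differ by a permutation of the variables: the affine
    coordinates \<open>(u, v)\<close> are \<open>(x_3/x_1, x_2/x_1)\<close>,
    \<open>(x_1/x_2, x_3/x_2)\<close> and \<open>(x_1/x_3, x_2/x_3)\<close>.\<close>
  define B1 where "B1 = B (cexp 0 0 3) (cexp 0 1 2) (cexp 1 0 2) (cexp 0 2 1) (cexp 1 1 1) (cexp 0 3 0) (cexp 1 2 0) (cexp 2 0 1) (cexp 2 1 0) (cexp 3 0 0)"
  define B2 where "B2 = B (cexp 3 0 0) (cexp 2 0 1) (cexp 2 1 0) (cexp 1 0 2) (cexp 1 1 1) (cexp 0 0 3) (cexp 0 1 2) (cexp 1 2 0) (cexp 0 2 1) (cexp 0 3 0)"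
  define B3 where "B3 = B (cexp 3 0 0) (cexp 2 1 0) (cexp 2 0 1) (cexp 1 2 0) (cexp 1 1 1) (cexp 0 3 0) (cexp 0 2 1) (cexp 1 0 2) (cexp 0 1 2) (cexp 0 0 3)"
  have "negligible B1" "negligible B2" "negligible B3"
    unfolding B1_def B2_def B3_def B_def
    by (rule negligible_singular_chart; simp add: cexp_eq_iff)+
  then have "closure (- (B1 \<union> B2 \<union> B3)) = UNIV"
    by (intro closure_Compl_negligible negligible_Un)
  moreover have "- smooth_cubics \<subseteq> B1 \<union> B2 \<union> B3"
  proof
    fix c assume "c \<in> - smooth_cubics"
    then obtain x :: "complex ^ 3" where x: "x \<noteq> 0"
      and "\<And>p. mp_eval id (($) x) (mp_deriv p (cubic_form c)) = 0"
      by (auto simp: smooth_cubics_def)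
    then have d: "mp_eval id (($) x) (mp_deriv 1 (cubic_form c)) = 0"
      "mp_eval id (($) x) (mp_deriv 2 (cubic_form c)) = 0" "mp_eval id (($) x) (mp_deriv 3 (cubic_form c)) = 0"
      by blast+
    from x consider "x $ 1 \<noteq> 0" | "x $ 2 \<noteq> 0" | "x $ 3 \<noteq> 0"
      by (auto simp: vec_eq_iff forall_3)
    then show "c \<in> B1 \<union> B2 \<union> B3"
    proof cases
      case 1
      define z u v where "z = x $ 1" and "u = x $ 3 / z" and "v = x $ 2 / z"
      then have x: "x $ 1 = z" "x $ 3 = u * z" "x $ 2 = v * z" and "z^2 \<noteq> 0" using 1 by auto
      \<comment> \<open>The partial derivatives are quadratic forms, so dehomogenizing splits off
        \<open>z^2\<close>. They are taken in the order of \<open>u\<close>, \<open>v\<close> and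
        the coordinate scaled to one.\<close>
      have "z^2 * (3 * c $ cexp 0 0 3 * u^2 + 2 * c $ cexp 0 1 2 * u * v + 2 * c $ cexp 1 0 2 * u + c $ cexp 0 2 1 * v^2 + c $ cexp 1 1 1 * v + c $ cexp 2 0 1) = 0"
        using d(3) unfolding mp_eval_mp_deriv_cubic_form x by (simp add: algebra_simps power2_eq_square)
      moreover have "z^2 * (c $ cexp 0 1 2 * u^2 + 2 * c $ cexp 0 2 1 * u * v + c $ cexp 1 1 1 * u + 3 * c $ cexp 0 3 0 * v^2 + 2 * c $ cexp 1 2 0 * v + c $ cexp 2 1 0) = 0"
        using d(2) unfolding mp_eval_mp_deriv_cubic_form x by (simp add: algebra_simps power2_eq_square)
      moreover have "z^2 * (c $ cexp 1 0 2 * u^2 + c $ cexp 1 1 1 * u * v + 2 * c $ cexp 2 0 1 * u + c $ cexp 1 2 0 * v^2 + 2 * c $ cexp 2 1 0 * v + 3 * c $ cexp 3 0 0) = 0"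
        using d(1) unfolding mp_eval_mp_deriv_cubic_form x by (simp add: algebra_simps power2_eq_square)
      ultimately have "c \<in> B1"
        using \<open>z^2 \<noteq> 0\<close> unfolding B1_def B_def mult_eq_0_iff by blast
      then show ?thesis by blast
    next
      case 2
      define z u v where "z = x $ 2" and "u = x $ 1 / z" and "v = x $ 3 / z"
      then have x: "x $ 2 = z" "x $ 1 = u * z" "x $ 3 = v * z" and "z^2 \<noteq> 0" using 2 by auto
      have "z^2 * (3 * c $ cexp 3 0 0 * u^2 + 2 * c $ cexp 2 0 1 * u * v + 2 * c $ cexp 2 1 0 * u + c $ cexp 1 0 2 * v^2 + c $ cexp 1 1 1 * v + c $ cexp 1 2 0) = 0"
        using d(1) unfolding mp_eval_mp_deriv_cubic_form x by (simp add: algebra_simps power2_eq_square)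
      moreover have "z^2 * (c $ cexp 2 0 1 * u^2 + 2 * c $ cexp 1 0 2 * u * v + c $ cexp 1 1 1 * u + 3 * c $ cexp 0 0 3 * v^2 + 2 * c $ cexp 0 1 2 * v + c $ cexp 0 2 1) = 0"
        using d(3) unfolding mp_eval_mp_deriv_cubic_form x by (simp add: algebra_simps power2_eq_square)
      moreover have "z^2 * (c $ cexp 2 1 0 * u^2 + c $ cexp 1 1 1 * u * v + 2 * c $ cexp 1 2 0 * u + c $ cexp 0 1 2 * v^2 + 2 * c $ cexp 0 2 1 * v + 3 * c $ cexp 0 3 0) = 0"
        using d(2) unfolding mp_eval_mp_deriv_cubic_form x by (simp add: algebra_simps power2_eq_square)
      ultimately have "c \<in> B2"
        using \<open>z^2 \<noteq> 0\<close> unfolding B2_def B_def mult_eq_0_iff by blast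
      then show ?thesis by blast
    next
      case 3
      define z u v where "z = x $ 3" and "u = x $ 1 / z" and "v = x $ 2 / z"
      then have x: "x $ 3 = z" "x $ 1 = u * z" "x $ 2 = v * z" and "z^2 \<noteq> 0" using 3 by auto
      have "z^2 * (3 * c $ cexp 3 0 0 * u^2 + 2 * c $ cexp 2 1 0 * u * v + 2 * c $ cexp 2 0 1 * u + c $ cexp 1 2 0 * v^2 + c $ cexp 1 1 1 * v + c $ cexp 1 0 2) = 0"
        using d(1) unfolding mp_eval_mp_deriv_cubic_form x by (simp add: algebra_simps power2_eq_square)
      moreover have "z^2 * (c $ cexp 2 1 0 * u^2 + 2 * c $ cexp 1 2 0 * u * v + c $ cexp 1 1 1 * u + 3 * c $ cexp 0 3 0 * v^2 + 2 * c $ cexp 0 2 1 * v + c $ cexp 0 1 2) = 0"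
        using d(2) unfolding mp_eval_mp_deriv_cubic_form x by (simp add: algebra_simps power2_eq_square)
      moreover have "z^2 * (c $ cexp 2 0 1 * u^2 + c $ cexp 1 1 1 * u * v + 2 * c $ cexp 1 0 2 * u + c $ cexp 0 2 1 * v^2 + 2 * c $ cexp 0 1 2 * v + 3 * c $ cexp 0 0 3) = 0"
        using d(3) unfolding mp_eval_mp_deriv_cubic_form x by (simp add: algebra_simps power2_eq_square)
      ultimately have "c \<in> B3"
        using \<open>z^2 \<noteq> 0\<close> unfolding B3_def B_def mult_eq_0_iff by blast
      then show ?thesis by blast
    qed
  qed
  then have "- (B1 \<union> B2 \<union> B3) \<subseteq> smooth_cubics" by blast
  ultimately show ?thesis using closure_mono by blast
qed

section \<open>Analytic and Zariski density of the operators\<close>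

lemma zariski_closed_imp_closed:
  assumes "zariski_closed Z" shows "closed Z"
proof -
  obtain F where "Z = {v. \<forall>P\<in>F. mp_eval id (($) v) P = 0}"
    using assms unfolding zariski_closed_def by blast
  then have "Z = (\<Inter>P\<in>F. {v. mp_eval id (($) v) P = 0})" by auto
  moreover have "closed {v. mp_eval id (($) v) P = 0}" for P
    unfolding mp_eval_def by (intro closed_Collect_eq continuous_intros)
  ultimately show ?thesis by blast
qed

theorem proposition7p20:
  fixes \<mu> :: "cubic_exp \<Rightarrow> complex"
  assumes "\<And>I. \<mu> I \<noteq> 0"
  shows "closure {l :: complex ^ cubic_exp. diff_zeros (first_order_op \<mu> l) \<noteq> {}} = UNIV
    \<and> zariski_closed hull {l :: complex ^ cubic_exp. diff_zeros (first_order_op \<mu> l) \<noteq> {}} = UNIV"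
proof -
  let ?T = "{l :: complex ^ cubic_exp. diff_zeros (first_order_op \<mu> l) \<noteq> {}}"
  have "l \<in> closure ?T" if l: "l $ cexp 2 1 0 \<noteq> 0" for l
  proof -
    \<comment> \<open>Dividing by \<open>\<mu>\<close> compensates for the weights that
      \<open>diff_zeros_lie_act\<close> introduces.\<close>
    have "(\<chi> I. l $ I / \<mu> I) $ cexp 2 1 0 \<noteq> 0" using l assms by simp
    then obtain \<xi> b where \<xi>: "trace \<xi> = 0" and b: "lie_act \<xi> b = (\<chi> I. l $ I / \<mu> I)"
      by (rule lie_act_solvable)
    \<comment> \<open>The cubic \<open>b\<close> just obtained may be singular. With
      \<open>\<xi>\<close> fixed, \<open>h\<close> is continuous and sends smooth cubics into the
      set in question, so approximating \<open>b\<close> by smooth cubics puts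
      \<open>l = h b\<close> in its closure.\<close>
    define h where "h b = (\<chi> I. \<mu> I * lie_act \<xi> b $ I)" for b
    have "continuous_on UNIV h"
      unfolding h_def by (intro continuous_intros continuous_on_lie_act)
    then have "h ` closure smooth_cubics \<subseteq> closure (h ` smooth_cubics)"
      by (intro image_closure_subset closed_closure closure_subset) (auto intro: continuous_on_subset)
    moreover have "h ` smooth_cubics \<subseteq> ?T"
      using diff_zeros_lie_act[of \<mu>, OF assms \<xi>] unfolding h_def by blast
    moreover have "l = h b" using assms by (simp add: h_def b vec_eq_iff)
    ultimately show ?thesis
      using closure_mono[of "h ` smooth_cubics" ?T] closure_smooth_cubics by blast
  qed
  then have "- {l. l $ cexp 2 1 0 = 0} \<subseteq> closure ?T" by blast
  then have "closure (- {l. l $ cexp 2 1 0 = 0}) \<subseteq> closure ?T" by (rule closure_minimal) simp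
  then have dense: "closure ?T = UNIV"
    unfolding closure_Compl_negligible[OF negligible_coord_zero] by blast
  \<comment> \<open>A Zariski closed set containing a dense set is closed and dense, so the hull is
    an intersection of copies of the whole space.\<close>
  moreover have "t = UNIV" if "zariski_closed t" "?T \<subseteq> t" for t
    using closure_minimal[OF that(2) zariski_closed_imp_closed[OF that(1)]] dense by blast
  then have "zariski_closed hull ?T = UNIV" unfolding hull_def by blast
  ultimately show ?thesis by blast
qed

end
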